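(* Let $\gamma>1$ be the Salem number with minimal polynomial $$P(x)=x^{18}-x^{12}-x^{11}-x^{10}-x^9-x^8-x^7-x^6+1.$$ Then $6/5<\gamma<13/10<\varphi$, where $\varphi=(1+\sqrt5)/2$, and there are arbitrarily large positive real numbers $t$ such that $\lfloor t\gamma^n\rfloor$ is even for every integer $n\ge0$. In particular, for these $t$ the sequences $(\lfloor t\gamma^n\rfloor)_{n\ge0}$ are not complete.
   Context: A Salem number is a real algebraic integer greater than one whose other conjugates lie in the closed unit disk, with at least one on the unit circle. A sequence of integers is complete if every sufficiently large integer is a sum of a finite selection of its terms with distinct indices (repeated values count as separate occurrences). *)

theory Defs
  imports "HOL-Computational_Algebra.Computational_Algebra" Complex_Main
begin

text \<open>Minimal polynomials are taken over the rationals.\<close>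

definition is_minimal_polynomial :: "rat poly \<Rightarrow> 'a :: field_char_0 \<Rightarrow> bool" where
  "is_minimal_polynomial p x \<longleftrightarrow>
     lead_coeff p = 1 \<and> poly (map_poly of_rat p) x = 0 \<and>
     (\<forall>q. q \<noteq> 0 \<and> poly (map_poly of_rat q) x = 0 \<longrightarrow> degree p \<le> degree q)"

text \<open>The conjugates include the number itself.\<close>

definition is_conjugate :: "complex \<Rightarrow> real \<Rightarrow> bool" where
  "is_conjugate z x \<longleftrightarrow>
     (\<exists>p. is_minimal_polynomial p x \<and> poly (map_poly of_rat p) z = 0)"

definition salem_number :: "real \<Rightarrow> bool" where
  "salem_number x \<longleftrightarrow>
     algebraic_int x \<and> x > 1 \<and>
     (\<forall>z. is_conjugate z x \<and> z \<noteq> of_real x \<longrightarrow> cmod z \<le> 1) \<and>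
     (\<exists>z. is_conjugate z x \<and> z \<noteq> of_real x \<and> cmod z = 1)"

definition complete_sequence :: "(nat \<Rightarrow> int) \<Rightarrow> bool" where
  "complete_sequence a \<longleftrightarrow>
     (\<exists>N. \<forall>m\<ge>N. \<exists>I. finite I \<and> m = (\<Sum>i\<in>I. a i))"

definition P :: "rat poly" where
  "P = monom 1 18 - monom 1 12 - monom 1 11 - monom 1 10 - monom 1 9
       - monom 1 8 - monom 1 7 - monom 1 6 + 1"

end

theory Submission
  imports Defs "HOL-Library.Z2"
begin

text \<open>Being reciprocal, the polynomial satisfies \<open>P(x) = x\<^sup>9 R(x + 1/x)\<close> with a polynomial \<open>R\<close> of degree
9, the trace polynomial. Sign changes show that \<open>R\<close> has nine real roots: one, \<open>y\<^sub>0\<close>, beyond 2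
and eight in \<open>(-2, 2)\<close>. Hence the roots of \<open>P\<close> are \<open>\<gamma>\<close> and \<open>1/\<gamma>\<close> with \<open>\<gamma> + 1/\<gamma> = y\<^sub>0\<close>
and sixteen points of the unit circle. As \<open>P\<close> stays irreducible modulo 2 (lemma
\<open>P_bits_factor_degree\<close>), it is the minimal polynomial of \<open>\<gamma>\<close>, which is therefore a Salem number.

The numbers \<open>t\<close> come from a trace form. For an integer polynomial \<open>p\<close> let
\<open>\<tau>(p) = 2 \<Sum> p(y) / ((y - 2) R'(y))\<close>, summed over the roots \<open>y\<close> of \<open>R\<close>. Write
\<open>p(y) = p(2) + (y - 2) q(y)\<close>. By Euler's formula the sum of \<open>q(y) / R'(y)\<close> is an integer, and by
partial fractions the sum of \<open>1 / ((y - 2) R'(y))\<close> is \<open>-1 / R(2) = 1/5\<close>. Therefore \<open>\<tau>(p)\<close> equals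
\<open>(2/5) p(2)\<close> up to an even integer, and it is an even integer plus \<open>2/5\<close> as soon as
\<open>p(2) \<equiv> 1 (mod 5)\<close> (lemma \<open>salem_trace_residue\<close>). It is this offset that keeps the integer part
even under a perturbation of either sign.

Take \<open>p\<^sub>n = \<theta>\<^bsup>2m\<^esup> c\<^sub>n\<close>. Here \<open>c\<^sub>0 = c\<^sub>1 = 1\<close> and \<open>c\<^bsub>n+2\<^esub> = y c\<^bsub>n+1\<^esub> - c\<^sub>n\<close>, so that \<open>c\<^sub>n(2) = 1\<close>,
each root in \<open>(-2, 2)\<close> gives a sequence \<open>c\<^sub>n(y)\<close> that is bounded in \<open>n\<close>, and
\<open>c\<^sub>n(\<gamma> + 1/\<gamma>) = (\<gamma>\<^sup>n + \<gamma> / \<gamma>\<^sup>n) / (1 + \<gamma>)\<close>. The polynomial \<open>\<theta>\<close> represents a Pisot number in the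
trace field up to sign: \<open>\<bar>\<theta>(y)\<bar> < 1\<close> at the eight small roots, and \<open>\<theta>(2) \<equiv> 1 (mod 5)\<close>. For large
\<open>m\<close> the small roots together contribute less than \<open>1/5\<close> to \<open>\<tau>(p\<^sub>n)\<close>, uniformly in \<open>n\<close>, and the
dominant root contributes \<open>T \<gamma>\<^sup>n + T \<gamma> / \<gamma>\<^sup>n\<close> with a fixed \<open>T > 0\<close>. So \<open>T \<gamma>\<^sup>n\<close> is eventually within
\<open>2/5\<close> of an even integer plus \<open>2/5\<close>, and its integer part is even (lemma \<open>ex_even_floors\<close>).
All sufficiently late terms \<open>t = T \<gamma>\<^sup>N\<close> then have the required property, and they are unbounded.\<close>

section \<open>Integer polynomials and minimal polynomials\<close>

abbreviation ipoly :: "int poly \<Rightarrow> 'a :: comm_ring_1 poly" where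
  "ipoly \<equiv> map_poly of_int"

lemma ipoly_add: "ipoly (p + q) = (ipoly p + ipoly q :: 'a :: comm_ring_1 poly)"
  by (rule poly_eqI) (simp add: coeff_map_poly)

lemma ipoly_diff: "ipoly (p - q) = (ipoly p - ipoly q :: 'a :: comm_ring_1 poly)"
  by (rule poly_eqI) (simp add: coeff_map_poly)

lemma ipoly_mult: "ipoly (p * q) = (ipoly p * ipoly q :: 'a :: comm_ring_1 poly)"
  by (rule poly_eqI) (simp add: coeff_map_poly coeff_mult)

lemma ipoly_power: "ipoly (p ^ n) = (ipoly p ^ n :: 'a :: comm_ring_1 poly)"
  by (induction n) (simp_all add: ipoly_mult)

lemma ipoly_smult: "ipoly (smult a p) = (smult (of_int a) (ipoly p) :: 'a :: comm_ring_1 poly)"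
  by (rule poly_eqI) (simp add: coeff_map_poly)

lemma of_rat_ipoly:
  "map_poly of_rat (ipoly p :: rat poly) = (ipoly p :: 'a :: field_char_0 poly)"
  by (rule poly_eqI) (simp add: coeff_map_poly)

lemma degree_ipoly [simp]: "degree (ipoly p :: 'a :: {comm_ring_1, ring_char_0} poly) = degree p"
  by (cases "p = 0") (auto intro!: map_poly_degree_eq)

lemma clear_denominators:
  fixes q :: "rat poly"
  obtains d :: int and p :: "int poly" where "d > 0" "ipoly p = smult (of_int d) q"
proof (induction q arbitrary: thesis)
  case 0
  show ?case by (rule 0[of 1 0]) simp_all
next
  case (pCons a q)
  obtain d p where dp: "d > 0" "ipoly p = smult (of_int d) q" by (rule pCons.IH)
  obtain m n where mn: "quotient_of a = (m, n)" by force
  then have n: "n > 0" and a: "a = of_int m / of_int n"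
    using quotient_of_denom_pos quotient_of_div by auto
  show ?case
  proof (rule pCons.prems)
    show "n * d > 0" using n dp by simp
    show "ipoly (pCons (m * d) (smult n p)) = smult (of_int (n * d)) (pCons a q)"
      using n by (simp add: map_poly_pCons ipoly_smult dp(2) a)
  qed
qed

text \<open>Gauss's lemma in the form needed here. Let \<open>p\<close> be a primitive integer polynomial of least degree
with root \<open>x\<close>. Pseudo-division of \<open>g\<close> by \<open>p\<close> leaves a remainder of smaller degree that vanishes at
\<open>x\<close>, hence no remainder; comparing primitive parts removes the scalar factor, so \<open>p\<close> divides \<open>g\<close>
over the integers, and only the trivial factorisation of \<open>g\<close> remains.\<close>

lemma is_minimal_polynomial_ipoly:
  fixes g :: "int poly" and x :: "'a :: field_char_0"
  assumes monic: "lead_coeff g = 1" and root: "poly (ipoly g) x = 0"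
    and irred: "\<And>f h. f * h = g \<Longrightarrow> degree f = 0 \<or> degree h = 0"
  shows "is_minimal_polynomial (ipoly g) x"
proof -
  define Z where "Z = (\<lambda>p :: int poly. p \<noteq> 0 \<and> poly (ipoly p) x = 0)"
  have "Z g" using monic root by (auto simp: Z_def)
  then obtain p0 where p0: "Z p0" and min: "\<And>q. Z q \<Longrightarrow> degree p0 \<le> degree q"
    using exists_least_iff[of "\<lambda>n. \<exists>p. Z p \<and> degree p = n"] by (metis not_less)
  define p where "p = primitive_part p0"
  have "ipoly p0 = (smult (of_int (content p0)) (ipoly p) :: 'a poly)"
    by (metis content_times_primitive_part ipoly_smult p_def)
  moreover have "content p0 \<noteq> 0" using p0 by (simp add: Z_def)
  ultimately have p: "Z p" using p0 by (auto simp: Z_def p_def)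
  have deg_p: "degree p = degree p0" by (simp add: p_def)
  have [simp]: "p \<noteq> 0" using p by (simp add: Z_def)
  obtain a s where a: "a \<noteq> 0" and as: "smult a g = p * s + pseudo_mod g p"
    using pseudo_mod(1)[of p g] by auto
  have "pseudo_mod g p = 0"
  proof (rule ccontr)
    assume nz: "pseudo_mod g p \<noteq> 0"
    have "ipoly (smult a g) = (ipoly p * ipoly s + ipoly (pseudo_mod g p) :: 'a poly)"
      by (simp add: as ipoly_add ipoly_mult)
    then have "poly (ipoly (pseudo_mod g p)) x = 0"
      using root p by (simp add: ipoly_smult Z_def) (metis add_0 mult_zero_left mult_zero_right
          poly_add poly_mult poly_smult)
    with nz min[of "pseudo_mod g p"] pseudo_mod(2)[of p g] deg_p show False
      by (auto simp: Z_def)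
  qed
  then have "primitive_part (smult a g) = primitive_part p * primitive_part s"
    using as by (simp add: primitive_part_mult)
  moreover have "content g = 1"
    using content_dvd_coeff[of g "degree g"] monic is_unit_content_iff[of g] by metis
  moreover have "primitive_part p = p"
    using p0 unfolding p_def by (intro primitive_part_prim) (simp add: Z_def)
  ultimately have sg: "smult (sgn a) g = p * primitive_part s"
    by (simp add: primitive_part_smult primitive_part_prim)
  have "sgn a * sgn a = 1" using a by (simp add: sgn_if)
  define h where "h = smult (sgn a) (primitive_part s)"
  have ph: "p * h = g"
    using arg_cong[OF sg, of "smult (sgn a)"] \<open>sgn a * sgn a = 1\<close> by (simp add: h_def)
  moreover from this have "h \<noteq> 0" using monic by auto
  ultimately have "degree g = degree p + degree h" using degree_mult_eq[of p h] by simp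
  moreover have "degree p = 0 \<or> degree h = 0" by (rule irred[OF ph])
  moreover have "degree p \<noteq> 0"
  proof
    assume "degree p = 0"
    then obtain c where "p = [:c:]" by (rule degree_eq_zeroE)
    with p show False by (simp add: Z_def map_poly_pCons)
  qed
  ultimately have deg: "degree g = degree p0" using deg_p by simp
  show ?thesis
    unfolding is_minimal_polynomial_def
  proof (intro conjI allI impI)
    show "lead_coeff (ipoly g :: rat poly) = 1" using monic by (simp add: coeff_map_poly)
    show "poly (map_poly of_rat (ipoly g)) x = 0" using root by (simp add: of_rat_ipoly)
    fix q :: "rat poly"
    assume q: "q \<noteq> 0 \<and> poly (map_poly of_rat q) x = 0"
    obtain d r where dr: "d > 0" "ipoly r = smult (of_int d) q" by (rule clear_denominators)
    have "map_poly of_rat (ipoly r :: rat poly) = smult (of_int d) (map_poly of_rat q :: 'a poly)"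
      unfolding dr(2) by (rule poly_eqI) (simp add: coeff_map_poly of_rat_mult)
    then have "poly (ipoly r) x = 0" using q by (simp add: of_rat_ipoly)
    moreover have "r \<noteq> 0" using dr q by auto
    ultimately have "degree p0 \<le> degree r" using min by (simp add: Z_def)
    also have "degree r = degree q"
      using dr degree_ipoly[of r, where 'a = rat] by simp
    finally show "degree (ipoly g :: rat poly) \<le> degree q" using deg by simp
  qed
qed

lemma minimal_polynomial_unique:
  fixes x :: "'a :: field_char_0"
  assumes "is_minimal_polynomial p x" "is_minimal_polynomial q x"
  shows "p = q"
proof (rule ccontr)
  assume "p \<noteq> q"
  have monic: "lead_coeff p = 1" "lead_coeff q = 1"
    using assms by (simp_all add: is_minimal_polynomial_def)
  then have "p \<noteq> 0" "q \<noteq> 0" by auto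
  then have "degree p = degree q"
    using assms unfolding is_minimal_polynomial_def by (blast intro: antisym)
  have "map_poly of_rat (p - q) = (map_poly of_rat p - map_poly of_rat q :: 'a poly)"
    by (rule poly_eqI) (simp add: coeff_map_poly of_rat_diff)
  then have "poly (map_poly of_rat (p - q)) x = 0"
    using assms by (simp add: is_minimal_polynomial_def)
  then have le: "degree p \<le> degree (p - q)"
    using assms \<open>p \<noteq> q\<close> by (auto simp: is_minimal_polynomial_def)
  then have "degree (p - q) = degree p"
    using degree_diff_le_max[of p q] \<open>degree p = degree q\<close> by simp
  then have "lead_coeff (p - q) = 0"
    using monic \<open>degree p = degree q\<close> by simp
  then have "p - q = 0" by (simp only: leading_coeff_0_iff)
  with \<open>p \<noteq> q\<close> show False by simp
qed

section \<open>Irreducibility of the Salem polynomial modulo two\<close>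

text \<open>A polynomial over the field with two elements is stored as its list of coefficients, the highest
one first, so that long division works from the head of the list; adding a shifted divisor is an
exclusive or with an initial segment.\<close>

fun xor_prefix :: "bool list \<Rightarrow> bool list \<Rightarrow> bool list" where
  "xor_prefix [] p = p"
| "xor_prefix (x # f) [] = []"
| "xor_prefix (x # f) (y # p) = (x \<noteq> y) # xor_prefix f p"

lemma length_xor_prefix [simp]: "length (xor_prefix f p) = length p"
  by (induction f p rule: xor_prefix.induct) auto

text \<open>Long division by the monic polynomial \<open>True # f\<close>. The leading coefficient of the divisor is left
implicit: it cancels the head of the dividend at each step.\<close>

function monic_divides :: "bool list \<Rightarrow> bool list \<Rightarrow> bool" where
  "monic_divides f [] = True"
| "monic_divides f (True # p) = (length f \<le> length p \<and> monic_divides f (xor_prefix f p))"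
| "monic_divides f (False # p) = monic_divides f p"
  by pat_completeness auto
termination
  by (relation "measure (\<lambda>(f, p). length p)") auto

fun bit_poly :: "bool list \<Rightarrow> bit poly" where
  "bit_poly [] = 0"
| "bit_poly (b # bs) = monom (of_bool b) (length bs) + bit_poly bs"

lemma degree_bit_poly: "bit_poly bs = 0 \<or> degree (bit_poly bs) < length bs"
proof (induction bs)
  case (Cons b bs)
  have "degree (bit_poly (b # bs)) \<le> length bs"
    using Cons by (auto intro!: degree_add_le degree_monom_le)
  then show ?case by simp
qed auto

lemma degree_monic_bit_poly: "degree (bit_poly (True # f)) = length f"
proof (cases "bit_poly f = 0")
  case False
  then have "degree (bit_poly f) < degree (monom (1 :: bit) (length f))"
    using degree_bit_poly[of f] by (simp add: degree_monom_eq)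
  then show ?thesis by (simp add: degree_add_eq_left degree_monom_eq)
qed (simp add: degree_monom_eq)

lemma monom_bit_add_self [simp]: "monom (a :: bit) n + monom a n = 0"
  by (simp add: add_monom)

lemma monom_bit_cancel [simp]: "monom (a :: bit) n + (monom a n + q) = q"
  by (simp flip: add.assoc)

lemma bit_poly_xor_prefix:
  "length f \<le> length p \<Longrightarrow>
     bit_poly (xor_prefix f p) = bit_poly f * monom 1 (length p - length f) + bit_poly p"
proof (induction f p rule: xor_prefix.induct)
  case (3 x f y p)
  have "monom (of_bool (x \<noteq> y)) n = monom (of_bool x) n + monom (of_bool y :: bit) n" for n
    by (cases x; cases y) simp_all
  with 3 show ?case by (simp add: algebra_simps mult_monom)
qed auto

text \<open>Each division step changes the dividend by a multiple of the divisor, so divisibility survives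
until nothing is left. Only this direction matters: a failing test refutes divisibility.\<close>

lemma monic_divides_complete:
  "bit_poly (True # f) dvd bit_poly p \<Longrightarrow> monic_divides f p"
proof (induction f p rule: monic_divides.induct)
  case (2 f p)
  have nz: "bit_poly (True # p) \<noteq> 0"
    using degree_bit_poly[of p]
    by (metis add.right_neutral bit_poly.simps(2) degree_0 degree_monic_bit_poly length_greater_0_conv
        monom_eq_0_iff of_bool_eq(2) zero_neq_one list.size(3) bit_poly.simps(1))
  from dvd_imp_degree_le[OF 2(2) nz] have len: "length f \<le> length p"
    by (simp only: degree_monic_bit_poly)
  have "bit_poly (xor_prefix f p)
      = bit_poly (True # f) * monom 1 (length p - length f) + bit_poly (True # p)"
    using len by (simp add: bit_poly_xor_prefix distrib_right mult_monom add_ac)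
  with 2 len show ?case by simp
qed auto

fun all_bit_lists :: "nat \<Rightarrow> (bool list \<Rightarrow> bool) \<Rightarrow> bool" where
  "all_bit_lists 0 Q = Q []"
| "all_bit_lists (Suc n) Q =
     (all_bit_lists n (\<lambda>l. Q (True # l)) \<and> all_bit_lists n (\<lambda>l. Q (False # l)))"

lemma all_bit_lists: "all_bit_lists n Q \<Longrightarrow> length l = n \<Longrightarrow> Q l"
proof (induction n arbitrary: Q l)
  case (Suc n)
  obtain b k where l: "l = b # k" "length k = n" using Suc.prems(2) by (cases l) auto
  have "all_bit_lists n (\<lambda>l. Q (b # l))" using Suc.prems(1) by (cases b) simp_all
  from Suc.IH[OF this l(2)] show ?case using l(1) by simp
qed simp

definition P_bits :: "bool list" where
  "P_bits = [True, False, False, False, False, False, True, True, True, True, True, True, True,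
     False, False, False, False, False, True]"

text \<open>A finite computation: trial division by 1022 monic candidates.\<close>

lemma no_small_monic_divisor:
  "list_all (\<lambda>d. all_bit_lists d (\<lambda>f. \<not> monic_divides f P_bits)) [1, 2, 3, 4, 5, 6, 7, 8, 9]"
  by code_simp

lemma ex_bit_list: "f \<noteq> 0 \<Longrightarrow> \<exists>l. length l = degree f \<and> f = bit_poly (True # l)"
proof -
  have *: "\<exists>l. length l = n \<and> f = bit_poly l" if "\<forall>i\<ge>n. coeff f i = 0" for n f
    using that
  proof (induction n arbitrary: f)
    case 0
    then show ?case by (simp add: poly_eq_iff)
  next
    case (Suc n)
    let ?g = "f + monom (coeff f n) n"
    have "coeff ?g i = 0" if "i \<ge> n" for i
      using Suc.prems that by (cases "i = n") auto
    then have "\<forall>i\<ge>n. coeff ?g i = 0" by blast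
    from Suc.IH[OF this] obtain l where l: "length l = n" "?g = bit_poly l" by blast
    have "f = monom (coeff f n) n + ?g" by (simp add: algebra_simps)
    also have "\<dots> = monom (of_bool (coeff f n = 1)) n + ?g"
      by (cases "coeff f n") simp_all
    also have "\<dots> = bit_poly ((coeff f n = 1) # l)"
      unfolding l(2) using l(1) by simp
    finally show ?case using l(1) by (intro exI[of _ "(coeff f n = 1) # l"]) simp
  qed
  assume "f \<noteq> 0"
  obtain b where "length b = Suc (degree f)" "f = bit_poly b"
    using *[of "Suc (degree f)" f] by (auto simp: coeff_eq_0)
  then obtain a l where l: "length l = degree f" "f = bit_poly (a # l)" by (cases b) auto
  have a
  proof (rule ccontr)
    assume "\<not> a"
    then have "f = bit_poly l" using l(2) by simp
    then have "degree f < length l" using degree_bit_poly[of l] \<open>f \<noteq> 0\<close> by metis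
    with l(1) show False by simp
  qed
  with l show ?thesis by auto
qed

text \<open>A proper factorisation of a polynomial of degree 18 has a factor of degree at most 9, so these
degrees suffice for irreducibility modulo 2.\<close>

lemma P_bits_factor_degree:
  assumes "f dvd bit_poly P_bits" "f \<noteq> 0" "degree f \<le> 9"
  shows "degree f = 0"
proof (rule ccontr)
  assume "degree f \<noteq> 0"
  obtain l where l: "length l = degree f" "f = bit_poly (True # l)"
    using ex_bit_list assms by blast
  have "degree f \<in> set [1, 2, 3, 4, 5, 6, 7, 8, 9]"
    using assms(3) \<open>degree f \<noteq> 0\<close> by auto
  then have "all_bit_lists (degree f) (\<lambda>f. \<not> monic_divides f P_bits)"
    using no_small_monic_divisor unfolding list_all_iff by blast
  then have "\<not> monic_divides l P_bits" using all_bit_lists[of _ _ l] l by blast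
  then show False using monic_divides_complete assms l by blast
qed

definition int_P :: "int poly" where
  "int_P = [:1, 0, 0, 0, 0, 0, -1, -1, -1, -1, -1, -1, -1, 0, 0, 0, 0, 0, 1:]"

lemma ipoly_int_P: "ipoly int_P = P"
  unfolding int_P_def P_def
  by (simp add: map_poly_pCons monom_altdef power_numeral_reduce one_pCons)

lemma ipoly_int_P_bit: "ipoly int_P = bit_poly P_bits"
  unfolding int_P_def P_bits_def
  by (simp add: map_poly_pCons monom_Suc monom_0 of_bool_def)

text \<open>The leading coefficients of integer factors of the monic polynomial are units, hence odd, and
reduction modulo 2 keeps the degrees.\<close>

lemma int_P_factor_degree:
  assumes "f * h = int_P"
  shows "degree f = 0 \<or> degree h = 0"
proof -
  have main: "degree f = 0" if fh: "f * h = int_P" and "degree f \<le> 9" for f h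
  proof -
    have "lead_coeff f * lead_coeff h = lead_coeff int_P"
      using fh lead_coeff_mult by metis
    also have "\<dots> = 1" by (simp add: int_P_def)
    finally have "odd (lead_coeff f)" by (metis dvd_mult2 odd_one)
    then have "of_int (lead_coeff f) \<noteq> (0 :: bit)" by (elim oddE) simp
    then have "coeff (ipoly f) (degree f) \<noteq> (0 :: bit)"
      and deg: "degree (ipoly f :: bit poly) = degree f"
      by (simp_all add: coeff_map_poly map_poly_degree_eq)
    then have nz: "ipoly f \<noteq> (0 :: bit poly)" by (metis coeff_0)
    have "ipoly f dvd bit_poly P_bits"
      by (metis dvd_triv_left fh ipoly_int_P_bit ipoly_mult)
    from P_bits_factor_degree[OF this nz] that deg show ?thesis by simp
  qed
  have "int_P \<noteq> 0" by (simp add: int_P_def)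
  then have "degree f + degree h = degree int_P"
    using assms degree_mult_eq by (metis mult_zero_left mult_zero_right)
  also have "\<dots> = 18" by (simp add: int_P_def)
  finally have "degree f \<le> 9 \<or> degree h \<le> 9" by linarith
  with main[of f h] main[of h f] assms show ?thesis by (auto simp: mult.commute)
qed

lemma poly_int_P:
  "poly (ipoly int_P) x =
     x ^ 18 - x ^ 12 - x ^ 11 - x ^ 10 - x ^ 9 - x ^ 8 - x ^ 7 - x ^ 6 + (1 :: 'a :: field_char_0)"
  unfolding int_P_def by (simp add: map_poly_pCons algebra_simps power_numeral_reduce)

lemma is_minimal_polynomial_P:
  fixes x :: "'a :: field_char_0"
  assumes "poly (ipoly int_P) x = 0"
  shows "is_minimal_polynomial P x"
proof -
  have "lead_coeff int_P = 1" by (simp add: int_P_def)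
  from is_minimal_polynomial_ipoly[OF this assms int_P_factor_degree]
  show ?thesis by (simp add: ipoly_int_P)
qed

section \<open>Location of the roots of the trace polynomial\<close>

definition trace_poly :: "'a :: comm_ring_1 poly" where
  "trace_poly = [:1, 11, -1, -31, 0, 27, 0, -9, 0, 1:]"

definition trace_roots :: "real set" where
  "trace_roots = {y. poly trace_poly y = 0}"

text \<open>The integer polynomial \<open>\<theta>\<close>. It was found by lattice reduction as a short integer polynomial that
is small at the eight roots of the trace polynomial in \<open>(-2, 2)\<close>; its value at the ninth root is
near -5065.\<close>

definition pisot_poly :: "int poly" where
  "pisot_poly = [:19, 214, 84, -534, -259, 374, 182, -78, -38:]"

abbreviation pisot :: "real \<Rightarrow> real" where
  "pisot \<equiv> poly (ipoly pisot_poly)"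

text \<open>Integer parts of \<open>10\<^sup>6 y\<close> for the eight roots \<open>y\<close> in \<open>(-2, 2)\<close>. The ninth root lies in the cell
with number 2051003.\<close>

definition small_root_floors :: "int list" where
  "small_root_floors = [-1985154, -1744373, -1182759, -752073, -92337, 840523, 1319460, 1545705]"

definition in_cell :: "int \<Rightarrow> real \<Rightarrow> bool" where
  "in_cell k y \<longleftrightarrow> y \<in> {of_int k / 10 ^ 6<..<(of_int k + 1) / 10 ^ 6}"

lemma sign_changes:
  "\<forall>k\<in>set (2051003 # small_root_floors).
     poly trace_poly (of_int k / 10 ^ 6) * poly trace_poly ((of_int k + 1) / 10 ^ 6) < (0 :: real)"
  unfolding small_root_floors_def trace_poly_def by simp

lemma pisot_at_cells:
  "\<forall>k\<in>set small_root_floors. \<bar>pisot (of_int k / 10 ^ 6)\<bar> < 3 / 4"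
  "\<bar>pisot (of_int 2051003 / 10 ^ 6)\<bar> > 1 / 4"
  unfolding small_root_floors_def pisot_poly_def by (simp_all add: map_poly_pCons)

lemma abs_poly_le:
  fixes p :: "real poly"
  assumes "\<bar>x\<bar> \<le> b"
  shows "\<bar>poly p x\<bar> \<le> poly (map_poly abs p) b"
proof (induction p)
  case (pCons a p)
  have "\<bar>poly (pCons a p) x\<bar> \<le> \<bar>a\<bar> + \<bar>x\<bar> * \<bar>poly p x\<bar>"
    by (simp add: abs_mult[symmetric] abs_triangle_ineq)
  also have "\<bar>x\<bar> * \<bar>poly p x\<bar> \<le> b * poly (map_poly abs p) b"
    using pCons assms by (intro mult_mono) auto
  finally show ?case by (simp add: map_poly_pCons)
qed simp

lemma poly_diff_le:
  fixes p :: "real poly"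
  assumes "x < y" "\<bar>x\<bar> \<le> b" "\<bar>y\<bar> \<le> b"
  shows "\<bar>poly p y - poly p x\<bar> \<le> (y - x) * poly (map_poly abs (pderiv p)) b"
proof -
  obtain z where z: "x < z" "z < y" "poly p y - poly p x = (y - x) * poly (pderiv p) z"
    using poly_MVT[OF assms(1)] by blast
  have "\<bar>poly p y - poly p x\<bar> = (y - x) * \<bar>poly (pderiv p) z\<bar>"
    using z assms(1) by (simp add: abs_mult)
  also have "\<dots> \<le> (y - x) * poly (map_poly abs (pderiv p)) b"
    using z assms by (intro mult_left_mono abs_poly_le) auto
  finally show ?thesis .
qed

text \<open>The derivative of \<open>\<theta>\<close> is at most 200000 in absolute value on \<open>[-2.1, 2.1]\<close>, and the cells
have width \<open>10\<^bsup>-6\<^esup>\<close>.\<close>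

lemma pisot_diff:
  assumes "in_cell k y" "\<bar>of_int k / 10 ^ 6 :: real\<bar> \<le> 2.06"
  shows "\<bar>pisot y - pisot (of_int k / 10 ^ 6)\<bar> < 1 / 4"
proof -
  let ?x = "of_int k / 10 ^ 6 :: real"
  have less: "?x < y" and *: "y - ?x < 1 / 10 ^ 6"
    using assms(1) by (simp_all add: in_cell_def add_divide_distrib)
  have "\<bar>pisot y - pisot ?x\<bar> \<le>
      (y - ?x) * poly (map_poly abs (pderiv (ipoly pisot_poly))) 2.1"
    using less * assms(2) by (intro poly_diff_le) (auto simp: abs_le_iff)
  also have "\<dots> \<le> (y - ?x) * 200000"
    using less by (intro mult_left_mono) (simp_all add: pisot_poly_def pderiv_pCons map_poly_pCons)
  also have "\<dots> < 1 / 4" using * by simp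
  finally show ?thesis .
qed

lemma ex_root_in_cell:
  assumes "k \<in> set (2051003 # small_root_floors)"
  shows "\<exists>y\<in>trace_roots. in_cell k y"
proof -
  let ?a = "of_int k / 10 ^ 6 :: real" and ?b = "(of_int k + 1) / 10 ^ 6 :: real"
  have "?a < ?b" by (simp add: divide_strict_right_mono)
  moreover have "poly trace_poly ?a * poly trace_poly ?b < (0 :: real)"
    using sign_changes assms by blast
  ultimately obtain y where "?a < y" "y < ?b" "poly trace_poly y = 0"
    using poly_IVT[of ?a ?b trace_poly] by blast
  then show ?thesis by (auto simp: trace_roots_def in_cell_def)
qed

lemma in_cell_floor:
  assumes "in_cell k y"
  shows "\<lfloor>y * 1000000\<rfloor> = k"
proof -
  have "of_int k / 1000000 < y" "y < (of_int k + 1) / 1000000"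
    using assms by (simp_all add: in_cell_def)
  then have "of_int k < y * 1000000" "y * 1000000 < of_int k + 1"
    by (simp_all only: pos_less_divide_eq pos_divide_less_eq zero_less_numeral)
  then show ?thesis by (intro floor_unique less_imp_le)
qed

text \<open>A polynomial of degree 9 has at most one root in each of nine disjoint cells once every cell has
one; so the cells account for all roots.\<close>

lemma
  shows card_trace_roots: "card trace_roots = 9"
    and trace_roots_in_cells: "y \<in> trace_roots \<Longrightarrow> \<exists>k\<in>set (2051003 # small_root_floors). in_cell k y"
    and large_root_unique: "\<exists>!y. y \<in> trace_roots \<and> in_cell 2051003 y"
proof -
  let ?ks = "set (2051003 # small_root_floors)"
  define r where "r = (\<lambda>k. SOME y. y \<in> trace_roots \<and> in_cell k y)"
  have r: "r k \<in> trace_roots \<and> in_cell k (r k)" if "k \<in> ?ks" for k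
    using ex_root_in_cell[OF that] someI_ex[of "\<lambda>y. y \<in> trace_roots \<and> in_cell k y"]
    unfolding r_def by blast
  have "inj_on r ?ks"
    by (rule inj_on_inverseI[of _ "\<lambda>y. \<lfloor>y * 1000000\<rfloor>"]) (use r in_cell_floor in blast)
  then have "card (r ` ?ks) = card ?ks" by (rule card_image)
  also have "\<dots> = 9" by (simp add: small_root_floors_def)
  finally have card_r: "card (r ` ?ks) = 9" .
  have nz: "(trace_poly :: real poly) \<noteq> 0" by (simp add: trace_poly_def)
  have fin: "finite trace_roots" 
    using poly_roots_finite[OF nz] by (simp add: trace_roots_def)
  have "card trace_roots \<le> 9"
    using card_poly_roots_bound[OF nz] by (simp add: trace_roots_def trace_poly_def)
  moreover have "r ` ?ks \<subseteq> trace_roots" using r by blast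
  ultimately have eq: "r ` ?ks = trace_roots"
    using card_r fin by (metis card_seteq)
  show "card trace_roots = 9" using card_r eq by simp
  show "\<exists>k\<in>?ks. in_cell k y" if "y \<in> trace_roots" for y
  proof -
    from that obtain k where k: "k \<in> ?ks" "y = r k" using eq by blast
    show ?thesis unfolding k(2) using k(1) r[OF k(1)] by blast
  qed
  show "\<exists>!y. y \<in> trace_roots \<and> in_cell 2051003 y"
  proof (rule ex_ex1I)
    show "\<exists>y. y \<in> trace_roots \<and> in_cell 2051003 y" 
      by (intro exI[of _ "r 2051003"] r list.set_intros(1))
    fix y z assume yz: "y \<in> trace_roots \<and> in_cell 2051003 y" "z \<in> trace_roots \<and> in_cell 2051003 z"
    then obtain k l where "k \<in> ?ks" "y = r k" "l \<in> ?ks" "z = r l" using eq by blast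
    moreover from this have "k = 2051003" "l = 2051003"
      using in_cell_floor r yz by metis+
    ultimately show "y = z" by simp
  qed
qed

lemma finite_trace_roots [simp]: "finite trace_roots"
  using card_trace_roots card.infinite by fastforce

definition dominant_root :: real where
  "dominant_root = (THE y. y \<in> trace_roots \<and> in_cell 2051003 y)"

lemma dominant_root: "dominant_root \<in> trace_roots" "in_cell 2051003 dominant_root"
  using theI'[OF large_root_unique] by (simp_all add: dominant_root_def)

lemma dominant_root_bounds: "41 / 20 < dominant_root" "dominant_root < 103 / 50"
  using dominant_root(2) by (simp_all add: in_cell_def)

lemma pisot_dominant_root: "pisot dominant_root \<noteq> 0"
  using pisot_diff[OF dominant_root(2)] pisot_at_cells(2) by auto

lemma
  assumes "y \<in> trace_roots" "y \<noteq> dominant_root"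
  shows small_trace_root: "\<bar>y\<bar> < 2"
    and pisot_small_root: "\<bar>pisot y\<bar> < 1"
proof -
  obtain k where "k \<in> set (2051003 # small_root_floors)" and y: "in_cell k y"
    using trace_roots_in_cells[OF assms(1)] by blast
  moreover have "k \<noteq> 2051003"
    using large_root_unique dominant_root y assms by metis
  ultimately have k: "k \<in> set small_root_floors" by simp
  then have "- 1990000 \<le> k" "k \<le> 1550000" unfolding small_root_floors_def by auto
  then have k': "- 199 / 100 \<le> of_int k / (10 ^ 6 :: real)" "of_int k / 10 ^ 6 \<le> (155 / 100 :: real)"
    by (simp_all add: divide_le_eq le_divide_eq)
  have y': "of_int k / 10 ^ 6 < y" "y < of_int k / 10 ^ 6 + 1 / 10 ^ 6"
    using y by (simp_all add: in_cell_def add_divide_distrib)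
  have "(1 / 10 ^ 6 :: real) \<le> 1 / 100" by simp
  with y' k' show "\<bar>y\<bar> < 2" by linarith
  have "\<bar>of_int k / 10 ^ 6 :: real\<bar> \<le> 2.06" using k' by (simp only: abs_le_iff) simp
  from pisot_diff[OF y this] bspec[OF pisot_at_cells(1) k] show "\<bar>pisot y\<bar> < 1" by linarith
qed

section \<open>The Salem number\<close>

text \<open>Multiplying by \<open>x\<^sup>9\<close> turns each power \<open>s\<^sup>k\<close> of \<open>s = x + 1/x\<close> into \<open>x\<^bsup>9-k\<^esup> (x\<^sup>2 + 1)\<^sup>k\<close>.\<close>

lemma poly_int_P_eq_trace_poly:
  fixes x :: "'a :: field_char_0"
  assumes "x \<noteq> 0"
  shows "poly (ipoly int_P) x = x ^ 9 * poly trace_poly (x + 1 / x)"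
proof -
  define s where "s = x + 1 / x"
  have xs: "x * s = x\<^sup>2 + 1" using assms by (simp add: s_def power2_eq_square field_simps)
  have "x ^ 9 * poly trace_poly s = x ^ 9 + 11 * x ^ 8 * (x * s) - x ^ 7 * (x * s) ^ 2
      - 31 * x ^ 6 * (x * s) ^ 3 + 27 * x ^ 4 * (x * s) ^ 5 - 9 * x ^ 2 * (x * s) ^ 7 + (x * s) ^ 9"
    by (simp add: trace_poly_def algebra_simps eval_nat_numeral)
  also have "\<dots> = poly (ipoly int_P) x"
    unfolding xs poly_int_P by (simp add: algebra_simps eval_nat_numeral)
  finally show ?thesis by (simp add: s_def)
qed

definition salem_root :: real where
  "salem_root = (dominant_root + sqrt (dominant_root\<^sup>2 - 4)) / 2"

lemma salem_root_gt_1: "salem_root > 1"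
proof -
  have "2\<^sup>2 < dominant_root\<^sup>2" using dominant_root_bounds by (intro power_strict_mono) auto
  then have "sqrt (dominant_root\<^sup>2 - 4) > 0" by simp
  then have "2 + 0 < dominant_root + sqrt (dominant_root\<^sup>2 - 4)"
    using dominant_root_bounds by (intro add_strict_mono) simp_all
  then show ?thesis by (simp add: salem_root_def)
qed

lemma salem_root_trace: "salem_root + 1 / salem_root = dominant_root"
proof -
  have "2\<^sup>2 \<le> dominant_root\<^sup>2" using dominant_root_bounds by (intro power_mono) auto
  then have "(sqrt (dominant_root\<^sup>2 - 4))\<^sup>2 = dominant_root\<^sup>2 - 4" by simp
  then have "salem_root * salem_root + 1 = dominant_root * salem_root"
    by (simp add: salem_root_def power2_eq_square field_simps)
  then show ?thesis using salem_root_gt_1 by (simp add: field_simps)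
qed

lemma poly_int_P_salem_root: "poly (ipoly int_P) salem_root = 0"
  using poly_int_P_eq_trace_poly[of salem_root] salem_root_gt_1 dominant_root(1)
  by (simp add: salem_root_trace trace_roots_def)

lemma sum_inverse_eq_iff:
  fixes x g :: "'a :: field"
  assumes "x \<noteq> 0" "g \<noteq> 0"
  shows "x + 1 / x = g + 1 / g \<longleftrightarrow> x = g \<or> x = 1 / g"
proof -
  have "x + 1 / x - (g + 1 / g) = (x - g) * (x - 1 / g) / x"
    using assms by (simp add: field_simps)
  then show ?thesis using assms by (metis divide_eq_0_iff mult_eq_0_iff right_minus_eq)
qed

lemma salem_root_unique:
  assumes "poly (ipoly int_P) x = 0" "x > (1 :: real)"
  shows "x = salem_root"
proof -
  have "x + 1 / x \<in> trace_roots"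
    using poly_int_P_eq_trace_poly[of x] assms by (simp add: trace_roots_def)
  moreover have "x + 1 / x > 2"
  proof -
    have "0 < (x - 1)\<^sup>2 / x" using assms by simp
    also have "\<dots> = x + 1 / x - 2" using assms by (simp add: power2_eq_square field_simps)
    finally show ?thesis by simp
  qed
  ultimately have "x + 1 / x = dominant_root" using small_trace_root by fastforce
  then have "x = salem_root \<or> x = 1 / salem_root"
    using sum_inverse_eq_iff[of x salem_root] assms salem_root_gt_1 salem_root_trace by simp
  moreover have "1 / salem_root < 1" using salem_root_gt_1 by simp
  ultimately show ?thesis using assms(2) by auto
qed

text \<open>The nine real roots already exhaust the degree.\<close>

lemma complex_trace_roots: "{w :: complex. poly trace_poly w = 0} = of_real ` trace_roots"
proof (rule sym, rule card_seteq)
  have nz: "(trace_poly :: complex poly) \<noteq> 0" by (simp add: trace_poly_def)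
  show "finite {w :: complex. poly trace_poly w = 0}" using poly_roots_finite[OF nz] .
  have "poly trace_poly (of_real y :: complex) = of_real (poly trace_poly y)" for y
    by (simp add: trace_poly_def)
  then show "of_real ` trace_roots \<subseteq> {w :: complex. poly trace_poly w = 0}"
    by (auto simp: trace_roots_def)
  have "card {w :: complex. poly trace_poly w = 0} \<le> 9"
    using card_poly_roots_bound[OF nz] by (simp add: trace_poly_def)
  then show "card {w :: complex. poly trace_poly w = 0} \<le> card (of_real ` trace_roots :: complex set)"
    by (simp add: card_image inj_on_def card_trace_roots)
qed

text \<open>Such a \<open>z\<close> is a root of the real quadratic \<open>X\<^sup>2 - y X + 1\<close>, whose discriminant is negative, so its
two roots are complex conjugates with product 1.\<close>

lemma norm_eq_1_if_real_trace:
  assumes "z \<noteq> 0" "z + 1 / z = of_real y" "\<bar>y\<bar> < 2"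
  shows "cmod z = 1"
proof -
  have eq: "z * z + 1 = of_real y * z"
    using assms(1) unfolding assms(2)[symmetric] by (simp add: field_simps)
  have re: "Re z * Re z - Im z * Im z + 1 = y * Re z" and im: "2 * Re z * Im z = y * Im z"
    using arg_cong[OF eq, of Re] arg_cong[OF eq, of Im] by simp_all
  have "Im z \<noteq> 0"
  proof
    assume "Im z = 0"
    then have "(2 * Re z - y)\<^sup>2 + (2 - y) * (2 + y) = 0"
      using re by (simp add: power2_eq_square algebra_simps)
    moreover have "(2 - y) * (2 + y) > 0" using assms(3) by (intro mult_pos_pos) auto
    ultimately show False using zero_le_power2[of "2 * Re z - y"] by linarith
  qed
  then have "y = 2 * Re z" using im by simp
  then have "Re z * Re z + Im z * Im z = 1" using re by (simp add: algebra_simps)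
  then show ?thesis by (simp add: cmod_def power2_eq_square)
qed

lemma norm_conjugate_le_1:
  assumes "poly (ipoly int_P) z = 0" "z \<noteq> of_real salem_root"
  shows "cmod z \<le> 1"
proof -
  have "z \<noteq> 0" using assms(1) by (auto simp: poly_int_P)
  then have "poly trace_poly (z + 1 / z) = 0"
    using poly_int_P_eq_trace_poly[of z] assms(1) by simp
  then obtain y where y: "y \<in> trace_roots" "z + 1 / z = of_real y"
    using complex_trace_roots by blast
  show ?thesis
  proof (cases "y = dominant_root")
    case True
    then have "z + 1 / z = of_real salem_root + 1 / of_real salem_root"
      using y salem_root_trace by (metis of_real_1 of_real_add of_real_divide)
    then have "z = 1 / of_real salem_root"
      using sum_inverse_eq_iff[of z "of_real salem_root"] assms(2) \<open>z \<noteq> 0\<close> salem_root_gt_1 by auto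
    then show ?thesis using salem_root_gt_1 by (simp add: norm_divide)
  next
    case False
    then show ?thesis
      using norm_eq_1_if_real_trace[OF \<open>z \<noteq> 0\<close> y(2)] small_trace_root y(1) by simp
  qed
qed

lemma ex_conjugate_norm_1: "\<exists>z. poly (ipoly int_P) z = 0 \<and> cmod z = 1"
proof -
  have "trace_roots \<noteq> {dominant_root}"
  proof
    assume eq: "trace_roots = {dominant_root}"
    have "card trace_roots = 1" unfolding eq by simp
    then show False by (simp add: card_trace_roots)
  qed
  then obtain y where y: "y \<in> trace_roots" "y \<noteq> dominant_root" using dominant_root(1) by blast
  define z where "z = Complex (y / 2) (sqrt (1 - (y / 2)\<^sup>2))"
  have "(y / 2)\<^sup>2 \<le> 1" using small_trace_root[OF y] by (simp add: abs_square_le_1)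
  then have "(sqrt (1 - (y / 2)\<^sup>2))\<^sup>2 = 1 - (y / 2)\<^sup>2"
    by (intro real_sqrt_pow2) linarith
  then have norm: "cmod z = 1" by (simp add: z_def cmod_def)
  then have "z \<noteq> 0" by auto
  have "1 / z = cnj z"
    using norm \<open>z \<noteq> 0\<close> by (simp add: divide_eq_eq complex_norm_square[symmetric] mult.commute)
  then have "z + 1 / z = of_real y" by (simp add: z_def complex_eq_iff)
  moreover have "poly trace_poly (of_real y :: complex) = 0" using complex_trace_roots y(1) by blast
  ultimately have "poly (ipoly int_P) z = 0"
    using poly_int_P_eq_trace_poly[OF \<open>z \<noteq> 0\<close>] by simp
  with norm show ?thesis by blast
qed

lemma is_conjugate_salem_root: "is_conjugate z salem_root \<longleftrightarrow> poly (ipoly int_P) z = 0"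
proof -
  have "is_minimal_polynomial p salem_root \<longleftrightarrow> p = P" for p
    using minimal_polynomial_unique is_minimal_polynomial_P[OF poly_int_P_salem_root] by blast
  then show ?thesis
    unfolding is_conjugate_def by (simp add: of_rat_ipoly flip: ipoly_int_P)
qed

lemma salem_number_salem_root: "salem_number salem_root"
  unfolding salem_number_def is_conjugate_salem_root
proof (intro conjI allI impI)
  have "lead_coeff int_P = 1" by (simp add: int_P_def)
  then show "algebraic_int salem_root"
    using poly_int_P_salem_root unfolding algebraic_int_altdef_ipoly by blast
  obtain z where z: "poly (ipoly int_P) z = 0" "cmod z = 1" using ex_conjugate_norm_1 by blast
  then have "z \<noteq> of_real salem_root" using salem_root_gt_1 by auto
  with z show "\<exists>z. poly (ipoly int_P) z = 0 \<and> z \<noteq> of_real salem_root \<and> cmod z = 1" by blast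
qed (use salem_root_gt_1 norm_conjugate_le_1 in auto)

text \<open>The map \<open>x \<mapsto> x + 1/x\<close> increases on \<open>[1, \<infinity>)\<close>, and \<open>6/5 + 5/6 < 2.05\<close> and \<open>13/10 + 10/13 > 2.06\<close>
enclose the dominant root.\<close>

lemma salem_root_bounds: "6 / 5 < salem_root" "salem_root < 13 / 10"
proof -
  have mono: "x + 1 / x \<le> y + 1 / y" if "1 \<le> x" "x \<le> y" for x y :: real
  proof -
    have "y + 1 / y - (x + 1 / x) = (y - x) * (x * y - 1) / (x * y)"
      using that by (simp add: field_simps)
    moreover have "1 \<le> x * y" using mult_mono[of 1 x 1 y] that by simp
    then have "0 \<le> (y - x) * (x * y - 1) / (x * y)"
      using that by (intro divide_nonneg_pos mult_nonneg_nonneg) linarith+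
    ultimately show ?thesis by linarith
  qed
  show "6 / 5 < salem_root"
  proof (rule ccontr)
    assume "\<not> 6 / 5 < salem_root"
    then have "salem_root + 1 / salem_root \<le> 6 / 5 + 1 / (6 / 5)"
      using salem_root_gt_1 by (intro mono) simp_all
    then show False using dominant_root_bounds by (simp add: salem_root_trace)
  qed
  show "salem_root < 13 / 10"
  proof (rule ccontr)
    assume "\<not> salem_root < 13 / 10"
    then have "13 / 10 + 1 / (13 / 10) \<le> salem_root + 1 / salem_root"
      by (intro mono) simp_all
    then show False using dominant_root_bounds by (simp add: salem_root_trace)
  qed
qed

section \<open>Interpolation sums over the roots of the trace polynomial\<close>

text \<open>Euler's formula: compare the leading coefficients in Lagrange's interpolation formula for \<open>f\<close> at
the points of \<open>Y\<close>.\<close>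

lemma lagrange_leading_coeff:
  fixes Y :: "'a :: field set"
  assumes fin: "finite Y" and deg: "degree f < card Y"
  shows "(\<Sum>a\<in>Y. poly f a / (\<Prod>b\<in>Y - {a}. a - b)) = coeff f (card Y - 1)"
proof -
  define L where "L = (\<lambda>a. \<Prod>b\<in>Y - {a}. [:- b, 1:])"
  define d where "d = (\<lambda>a. \<Prod>b\<in>Y - {a}. a - b)"
  have deg_L: "degree (L a) = card Y - 1" if "a \<in> Y" for a
    using that fin by (simp add: L_def degree_prod_sum_eq)
  have monic_L: "coeff (L a) (card Y - 1) = 1" if "a \<in> Y" for a
    using lead_coeff_prod[of "\<lambda>b. [:- b, 1:]" "Y - {a}"] deg_L[OF that] by (simp add: L_def)
  have poly_L: "poly (L a) c = (if c = a then d a else 0)" if "a \<in> Y" "c \<in> Y" for a c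
    using that fin by (auto simp: L_def d_def poly_prod prod_zero_iff)
  have d: "d a \<noteq> 0" for a using fin by (simp add: d_def)
  define F where "F = (\<Sum>a\<in>Y. smult (poly f a / d a) (L a))"
  have "f = F"
  proof (rule poly_eqI_degree[where A = Y])
    show "poly f c = poly F c" if "c \<in> Y" for c
    proof -
      have "poly F c = (\<Sum>a\<in>Y. if c = a then poly f a else 0)"
        unfolding F_def poly_sum by (rule sum.cong) (use that poly_L d in auto)
      then show ?thesis using that fin by simp
    qed
    have "degree F \<le> card Y - 1"
      unfolding F_def using deg_L fin
      by (intro degree_sum_le) (auto intro: order.trans[OF degree_smult_le])
    with deg show "degree F < card Y" by simp
  qed (use deg in simp_all)
  moreover have "coeff F (card Y - 1) = (\<Sum>a\<in>Y. poly f a / d a)"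
    unfolding F_def coeff_sum
    by (rule sum.cong[OF refl]) (simp only: coeff_smult monic_L mult_1_right)
  ultimately show ?thesis by (simp only: d_def)
qed

lemma trace_poly_eq_prod: "trace_poly = (\<Prod>y\<in>trace_roots. [:- y, 1:])"
proof (rule poly_eqI_degree_lead_coeff[where n = 9 and A = trace_roots])
  have "degree (\<Prod>y\<in>trace_roots. [:- y, 1:]) = 9"
    by (simp add: degree_prod_sum_eq card_trace_roots)
  then show "degree (\<Prod>y\<in>trace_roots. [:- y, 1:]) \<le> 9"
    and "coeff trace_poly 9 = coeff (\<Prod>y\<in>trace_roots. [:- y, 1:]) 9"
    using lead_coeff_prod[of "\<lambda>y. [:- y, 1:]" trace_roots]
    by (simp_all add: trace_poly_def eval_nat_numeral)
  show "poly trace_poly y = poly (\<Prod>y\<in>trace_roots. [:- y, 1:]) y" if "y \<in> trace_roots" for y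
  proof -
    have "poly trace_poly y = 0" using that by (simp add: trace_roots_def)
    then show ?thesis using that by (simp add: poly_prod)
  qed
qed (simp_all add: card_trace_roots, simp add: trace_poly_def)

text \<open>The derivative of the trace polynomial at its root \<open>y\<close>, in the shape in which it occurs in
interpolation formulas.\<close>

definition trace_deriv :: "real \<Rightarrow> real" where
  "trace_deriv y = (\<Prod>b\<in>trace_roots - {y}. y - b)"

lemma trace_deriv_nonzero: "trace_deriv y \<noteq> 0"
  by (simp add: trace_deriv_def)

text \<open>For exponents up to 8 this is Euler's formula with the value 0 or 1; beyond that the sums satisfy
the recurrence with integer coefficients given by the monic trace polynomial.\<close>

lemma power_sum_integral: "(\<Sum>y\<in>trace_roots. y ^ k / trace_deriv y) \<in> \<int>"
proof (induction k rule: less_induct)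
  case (less k)
  show ?case
  proof (cases "k < 9")
    case True
    then have "degree (monom (1 :: real) k) < card trace_roots"
      by (simp add: degree_monom_eq card_trace_roots)
    from lagrange_leading_coeff[OF finite_trace_roots this] show ?thesis
      by (simp add: trace_deriv_def poly_monom)
  next
    case False
    define j where "j = k - 9"
    have k: "k = j + 9" using False by (simp add: j_def)
    define S where "S = (\<lambda>i. \<Sum>y\<in>trace_roots. y ^ (j + i) / trace_deriv y)"
    have "y ^ (j + 9) / trace_deriv y = (9 * y ^ (j + 7) - 27 * y ^ (j + 5) + 31 * y ^ (j + 3)
        + y ^ (j + 2) - 11 * y ^ (j + 1) - y ^ (j + 0)) / trace_deriv y" if "y \<in> trace_roots" for y
    proof -
      have y9: "y ^ 9 = 9 * y ^ 7 - 27 * y ^ 5 + 31 * y ^ 3 + y ^ 2 - 11 * y - 1"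
        using that by (simp add: trace_roots_def trace_poly_def algebra_simps eval_nat_numeral)
      then show ?thesis
        unfolding power_add y9 by (simp add: algebra_simps eval_nat_numeral)
    qed
    then have "S 9 = 9 * S 7 - 27 * S 5 + 31 * S 3 + S 2 - 11 * S 1 - S 0"
      unfolding S_def
      by (simp add: sum_distrib_left sum.distrib sum_subtractf add_divide_distrib diff_divide_distrib)
    moreover have "S i \<in> \<int>" if "i < 9" for i
      unfolding S_def using less[of "j + i"] that k by simp
    ultimately have "S 9 \<in> \<int>"
      by (auto intro!: Ints_add Ints_diff Ints_mult)
    then show ?thesis by (simp add: S_def k)
  qed
qed

lemma ipoly_sum_integral: "(\<Sum>y\<in>trace_roots. poly (ipoly q) y / trace_deriv y) \<in> \<int>"
proof -
  have "(\<Sum>y\<in>trace_roots. poly (ipoly q) y / trace_deriv y)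
      = (\<Sum>y\<in>trace_roots. \<Sum>i\<le>degree q. of_int (coeff q i) * (y ^ i / trace_deriv y))"
    by (simp add: poly_altdef coeff_map_poly sum_divide_distrib)
  also have "\<dots> = (\<Sum>i\<le>degree q. of_int (coeff q i) * (\<Sum>y\<in>trace_roots. y ^ i / trace_deriv y))"
    by (subst sum.swap) (simp add: sum_distrib_left)
  also have "\<dots> \<in> \<int>"
    by (intro Ints_sum Ints_mult power_sum_integral) simp
  finally show ?thesis .
qed

lemma two_not_root: "2 \<notin> trace_roots"
  by (simp add: trace_roots_def trace_poly_def)

text \<open>Euler's formula for the constant 1 at the ten points consisting of the roots and 2: the sum
vanishes, and the term of the point 2 is \<open>1 / R(2) = -1/5\<close>.\<close>

lemma sum_inverse_trace_roots: "(\<Sum>y\<in>trace_roots. 1 / ((y - 2) * trace_deriv y)) = 1 / 5"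
proof -
  let ?Y = "insert 2 trace_roots"
  have card: "card ?Y = 10" by (simp add: card_trace_roots two_not_root)
  then have "0 = (\<Sum>a\<in>?Y. 1 / (\<Prod>b\<in>?Y - {a}. a - b))"
    using lagrange_leading_coeff[of ?Y 1] by simp
  also have "\<dots> = 1 / (\<Prod>b\<in>trace_roots. 2 - b)
      + (\<Sum>a\<in>trace_roots. 1 / (\<Prod>b\<in>?Y - {a}. a - b))"
    using two_not_root by simp
  also have "(\<Prod>b\<in>trace_roots. 2 - b) = poly trace_poly 2"
    unfolding trace_poly_eq_prod poly_prod by simp
  also have "\<dots> = - 5" by (simp add: trace_poly_def)
  also have "(\<Sum>a\<in>trace_roots. 1 / (\<Prod>b\<in>?Y - {a}. a - b))
      = (\<Sum>a\<in>trace_roots. 1 / ((a - 2) * trace_deriv a))"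
  proof (rule sum.cong[OF refl])
    fix a assume "a \<in> trace_roots"
    then have "?Y - {a} = insert 2 (trace_roots - {a})" using two_not_root by auto
    then show "1 / (\<Prod>b\<in>?Y - {a}. a - b) = 1 / ((a - 2) * trace_deriv a)"
      using two_not_root by (simp add: trace_deriv_def)
  qed
  finally show ?thesis by simp
qed

text \<open>Up to the choice of a factor, the trace form of the field generated by a root of the trace
polynomial. The denominator \<open>y - 2\<close> divides 5, because \<open>R(2) = -5\<close>; it is what produces fifths.\<close>

definition salem_trace :: "int poly \<Rightarrow> real" where
  "salem_trace p = 2 * (\<Sum>y\<in>trace_roots. poly (ipoly p) y / ((y - 2) * trace_deriv y))"

lemma salem_trace_residue:
  "\<exists>z :: int. salem_trace p = 2 / 5 * of_int (poly p 2) + 2 * of_int z"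
proof -
  have "[:- 2, 1:] dvd p - [:poly p 2:]"
    by (simp flip: poly_eq_0_iff_dvd)
  then obtain q where "p - [:poly p 2:] = [:- 2, 1:] * q" by (elim dvdE)
  then have p: "p = [:poly p 2:] + [:- 2, 1:] * q" by (simp add: diff_eq_eq add.commute)
  have "poly (ipoly p) y / ((y - 2) * trace_deriv y)
      = of_int (poly p 2) * (1 / ((y - 2) * trace_deriv y)) + poly (ipoly q) y / trace_deriv y"
    if "y \<in> trace_roots" for y
  proof -
    have "y - 2 \<noteq> 0" using that two_not_root by auto
    moreover have "poly (ipoly p) y = of_int (poly p 2) + (y - 2) * poly (ipoly q) y"
      by (subst p) (simp add: ipoly_add ipoly_mult map_poly_pCons del: mult_pCons_left)
    ultimately show ?thesis by (simp add: add_divide_distrib)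
  qed
  then have "salem_trace p = 2 * (of_int (poly p 2) * (1 / 5)
      + (\<Sum>y\<in>trace_roots. poly (ipoly q) y / trace_deriv y))"
    unfolding salem_trace_def sum_inverse_trace_roots[symmetric]
    by (simp add: sum.distrib sum_distrib_left)
  moreover obtain z where "(\<Sum>y\<in>trace_roots. poly (ipoly q) y / trace_deriv y) = of_int z"
    using ipoly_sum_integral Ints_cases by blast
  ultimately show ?thesis by (intro exI[of _ z]) simp
qed

section \<open>Chebyshev-type polynomials\<close>

text \<open>At \<open>y = 2 cos \<phi>\<close> the value is \<open>cos ((n - 1/2) \<phi>) / cos (\<phi>/2)\<close>. The sequence is symmetric under
\<open>n \<mapsto> 1 - n\<close> and constant at \<open>y = 2\<close>.\<close>

fun half_chebyshev :: "nat \<Rightarrow> int poly" where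
  "half_chebyshev 0 = 1"
| "half_chebyshev (Suc 0) = 1"
| "half_chebyshev (Suc (Suc n)) = [:0, 1:] * half_chebyshev (Suc n) - half_chebyshev n"

lemma poly_half_chebyshev_rec:
  fixes y :: "'a :: comm_ring_1"
  shows "poly (ipoly (half_chebyshev (Suc (Suc n)))) y =
    y * poly (ipoly (half_chebyshev (Suc n))) y - poly (ipoly (half_chebyshev n)) y"
  by (simp add: ipoly_diff ipoly_mult map_poly_pCons del: mult_pCons_left)

lemma half_chebyshev_at_2: "poly (half_chebyshev n) 2 = 1"
  by (induction n rule: half_chebyshev.induct) simp_all

text \<open>The recurrence preserves the quadratic form \<open>a\<^sup>2 - y a b + b\<^sup>2\<close> of consecutive terms, which is
positive definite for \<open>\<bar>y\<bar> < 2\<close>.\<close>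

lemma half_chebyshev_bounded:
  fixes y :: real
  assumes "\<bar>y\<bar> < 2"
  shows "\<bar>poly (ipoly (half_chebyshev n)) y\<bar> \<le> 2 / sqrt (2 + y)"
proof -
  let ?c = "\<lambda>n. poly (ipoly (half_chebyshev n)) y"
  have inv: "(?c n)\<^sup>2 - y * ?c n * ?c (Suc n) + (?c (Suc n))\<^sup>2 = 2 - y" for n
  proof (induction n)
    case (Suc n)
    then show ?case
      unfolding poly_half_chebyshev_rec by (simp add: power2_eq_square algebra_simps)
  qed simp
  have "(2 - y) * ((2 + y) * (?c n)\<^sup>2) = 4 * (2 - y) - (2 * ?c (Suc n) - y * ?c n)\<^sup>2"
    using inv[of n] by (simp add: power2_eq_square algebra_simps)
  also have "\<dots> \<le> (2 - y) * 4" by simp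
  finally have "(2 + y) * (?c n)\<^sup>2 \<le> 4"
    by (rule mult_left_le_imp_le) (use assms in simp)
  then have "(sqrt (2 + y) * \<bar>?c n\<bar>)\<^sup>2 \<le> 2\<^sup>2"
    using assms by (simp add: power_mult_distrib)
  then have "sqrt (2 + y) * \<bar>?c n\<bar> \<le> 2" by (rule power2_le_imp_le) simp
  then show ?thesis using assms by (simp add: field_simps)
qed

lemma half_chebyshev_closed_form:
  fixes g :: "'a :: field_char_0"
  assumes "g \<noteq> 0"
  shows "(1 + g) * poly (ipoly (half_chebyshev n)) (g + 1 / g) = g ^ n + g / g ^ n"
  using assms
proof (induction n rule: half_chebyshev.induct)
  case (3 n)
  then show ?case
    unfolding poly_half_chebyshev_rec
    by (simp add: right_diff_distrib mult.left_commute[of "1 + g"]) (simp add: field_simps)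
qed simp_all

section \<open>Even integer parts\<close>

lemma trace_deriv_dominant_root_pos: "trace_deriv dominant_root > 0"
  unfolding trace_deriv_def
proof (rule prod_pos)
  fix b assume "b \<in> trace_roots - {dominant_root}"
  then show "0 < dominant_root - b" using small_trace_root[of b] dominant_root_bounds by auto
qed

lemma poly_pisot_at_2: "poly pisot_poly 2 ^ m mod 5 = 1"
proof -
  have "poly pisot_poly 2 mod 5 = 1" by (simp add: pisot_poly_def)
  moreover have "poly pisot_poly 2 ^ m mod 5 = (poly pisot_poly 2 mod 5) ^ m mod 5"
    by (simp only: power_mod)
  ultimately show ?thesis by simp
qed

text \<open>The exponent \<open>m\<close> is fixed first, to make the small roots negligible for all \<open>n\<close> at once; after
that \<open>n\<close> has to be large only to suppress the term \<open>\<gamma> / \<gamma>\<^sup>n\<close> that comes from the conjugate \<open>1/\<gamma>\<close>.\<close>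

lemma ex_even_floors:
  "\<exists>T>0. \<forall>\<^sub>F n in sequentially. even \<lfloor>T * salem_root ^ n\<rfloor>"
proof -
  let ?Y = "trace_roots - {dominant_root}" and ?g = salem_root
  \<comment> \<open>A bound for the contribution of a small root, without the power of its value under \<open>\<theta>\<close>.\<close>
  define w where "w = (\<lambda>y. 2 * (2 / sqrt (2 + y)) / \<bar>(y - 2) * trace_deriv y\<bar>)"
  have "(\<lambda>m. \<Sum>y\<in>?Y. w y * (pisot y ^ 2) ^ m) \<longlonglongrightarrow> (\<Sum>y\<in>?Y. w y * 0)"
  proof (intro tendsto_sum tendsto_mult tendsto_const LIMSEQ_power_zero)
    fix y assume "y \<in> ?Y"
    then show "norm (pisot y ^ 2) < 1" using pisot_small_root[of y] by (simp add: abs_square_less_1)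
  qed
  then have "\<forall>\<^sub>F m in sequentially. (\<Sum>y\<in>?Y. w y * (pisot y ^ 2) ^ m) < 1 / 5"
    by (rule order_tendstoD) simp
  then obtain m where m: "(\<Sum>y\<in>?Y. w y * (pisot y ^ 2) ^ m) < 1 / 5"
    using eventually_happens' sequentially_bot by blast
  \<comment> \<open>The even exponent makes the contribution of the dominant root positive, where \<open>\<theta>\<close> is negative.\<close>
  define p where "p = (\<lambda>n. pisot_poly ^ (2 * m) * half_chebyshev n)"
  have poly_p: "poly (ipoly (p n)) y = (pisot y ^ 2) ^ m * poly (ipoly (half_chebyshev n)) y" for n y
    by (simp add: p_def ipoly_mult ipoly_power power_mult)
  define tail where "tail = (\<lambda>n. 2 * (\<Sum>y\<in>?Y. poly (ipoly (p n)) y / ((y - 2) * trace_deriv y)))"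
  have tail: "\<bar>tail n\<bar> < 1 / 5" for n
  proof -
    have "\<bar>tail n\<bar> \<le> (\<Sum>y\<in>?Y. \<bar>2 * (poly (ipoly (p n)) y / ((y - 2) * trace_deriv y))\<bar>)"
      unfolding tail_def sum_distrib_left by (rule sum_abs)
    also have "\<dots> \<le> (\<Sum>y\<in>?Y. w y * (pisot y ^ 2) ^ m)"
    proof (rule sum_mono)
      fix y assume "y \<in> ?Y"
      then have "\<bar>poly (ipoly (half_chebyshev n)) y\<bar> \<le> 2 / sqrt (2 + y)"
        using half_chebyshev_bounded small_trace_root by blast
      then have "2 * \<bar>poly (ipoly (half_chebyshev n)) y\<bar> / \<bar>(y - 2) * trace_deriv y\<bar> * (pisot y ^ 2) ^ m
          \<le> w y * (pisot y ^ 2) ^ m"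
        unfolding w_def by (intro mult_right_mono divide_right_mono) simp_all
      then show "\<bar>2 * (poly (ipoly (p n)) y / ((y - 2) * trace_deriv y))\<bar> \<le> w y * (pisot y ^ 2) ^ m"
        by (simp add: poly_p abs_mult abs_divide mult_ac)
    qed
    finally show ?thesis using m by simp
  qed
  define T where
    "T = 2 * (pisot dominant_root ^ 2) ^ m / ((dominant_root - 2) * trace_deriv dominant_root * (1 + ?g))"
  have "T > 0"
    using dominant_root_bounds trace_deriv_dominant_root_pos salem_root_gt_1 pisot_dominant_root
    by (simp add: T_def)
  have trace_eq: "salem_trace (p n) = T * ?g ^ n + T * (?g / ?g ^ n) + tail n" for n
  proof -
    have c: "poly (ipoly (half_chebyshev n)) dominant_root = (?g ^ n + ?g / ?g ^ n) / (1 + ?g)"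
      using half_chebyshev_closed_form[of ?g n] salem_root_gt_1
      by (simp add: salem_root_trace eq_divide_eq mult.commute)
    have "salem_trace (p n) = 2 * (poly (ipoly (p n)) dominant_root
        / ((dominant_root - 2) * trace_deriv dominant_root)) + tail n"
      unfolding salem_trace_def tail_def
      by (subst sum.remove[OF finite_trace_roots dominant_root(1)]) (simp add: distrib_left)
    also have "2 * (poly (ipoly (p n)) dominant_root
        / ((dominant_root - 2) * trace_deriv dominant_root)) = T * (?g ^ n + ?g / ?g ^ n)"
      unfolding poly_p c T_def by (simp add: mult_ac)
    finally show ?thesis by (simp add: distrib_left)
  qed
  have even_part: "\<exists>z :: int. salem_trace (p n) = 2 / 5 + 2 * of_int z" for n
  proof -
    have "poly (p n) 2 mod 5 = 1"
      by (simp add: p_def poly_mult half_chebyshev_at_2 poly_power poly_pisot_at_2)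
    then obtain q where q: "poly (p n) 2 = 1 + 5 * q" by (metis mod_mult_div_eq)
    moreover obtain z where "salem_trace (p n) = 2 / 5 * of_int (poly (p n) 2) + 2 * of_int z"
      using salem_trace_residue by blast
    ultimately have "salem_trace (p n) = 2 / 5 + 2 * of_int (q + z)"
      by (simp add: algebra_simps)
    then show ?thesis by blast
  qed
  have "(\<lambda>n. T * (?g / ?g ^ n)) \<longlonglongrightarrow> T * 0"
    using salem_root_gt_1 by (intro tendsto_mult tendsto_const LIMSEQ_divide_realpow_zero)
  then have "\<forall>\<^sub>F n in sequentially. T * (?g / ?g ^ n) < 1 / 5"
    by (rule order_tendstoD) simp
  then have "\<forall>\<^sub>F n in sequentially. even \<lfloor>T * ?g ^ n\<rfloor>"
  proof eventually_elim
    case (elim n)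
    obtain z :: int where "salem_trace (p n) = 2 / 5 + 2 * of_int z" using even_part by blast
    moreover have "T * (?g / ?g ^ n) > 0" using \<open>T > 0\<close> salem_root_gt_1 by simp
    \<comment> \<open>The two errors lie in \<open>(0, 1/5)\<close> and \<open>(-1/5, 1/5)\<close>, so the offset \<open>2/5\<close> absorbs them.\<close>
    ultimately have "2 * of_int z \<le> T * ?g ^ n" "T * ?g ^ n < 2 * of_int z + 1"
      using trace_eq[of n] tail[of n] elim by linarith+
    then have "\<lfloor>T * ?g ^ n\<rfloor> = 2 * z" by (intro floor_unique) simp_all
    then show ?case by simp
  qed
  with \<open>T > 0\<close> show ?thesis by blast
qed

lemma not_complete_if_even:
  assumes "\<And>n. even (a n)"
  shows "\<not> complete_sequence a"
proof
  assume "complete_sequence a"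
  then obtain N where N: "\<And>m. m \<ge> N \<Longrightarrow> \<exists>I. finite I \<and> m = (\<Sum>i\<in>I. a i)"
    unfolding complete_sequence_def by blast
  \<comment> \<open>An odd number beyond the threshold.\<close>
  obtain I where "2 * \<bar>N\<bar> + 1 = (\<Sum>i\<in>I. a i)" 
    using N[of "2 * \<bar>N\<bar> + 1"] by fastforce
  moreover have "even (\<Sum>i\<in>I. a i)" using assms by (intro dvd_sum) auto
  ultimately have "even (2 * \<bar>N\<bar> + 1)" by simp
  then show False by simp
qed

theorem theorem9:
  shows "(\<exists>!\<gamma>::real. salem_number \<gamma> \<and> is_minimal_polynomial P \<gamma>) \<and>
    (\<forall>\<gamma>::real. salem_number \<gamma> \<and> is_minimal_polynomial P \<gamma> \<longrightarrow>
       6 / 5 < \<gamma> \<and> \<gamma> < 13 / 10 \<and> 13 / 10 < (1 + sqrt 5) / 2 \<and>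
       (\<forall>B::real. \<exists>t::real. t > B \<and> t > 0 \<and> (\<forall>n::nat. even \<lfloor>t * \<gamma> ^ n\<rfloor>)) \<and>
       (\<forall>t::real. t > 0 \<and> (\<forall>n::nat. even \<lfloor>t * \<gamma> ^ n\<rfloor>) \<longrightarrow>
          \<not> complete_sequence (\<lambda>n. \<lfloor>t * \<gamma> ^ n\<rfloor>)))"
proof -
  have unique: "\<gamma> = salem_root" if "salem_number \<gamma>" "is_minimal_polynomial P \<gamma>" for \<gamma>
  proof (rule salem_root_unique)
    show "\<gamma> > 1" using that(1) by (simp add: salem_number_def)
    show "poly (ipoly int_P) \<gamma> = 0"
      using that(2) by (simp add: is_minimal_polynomial_def of_rat_ipoly flip: ipoly_int_P)
  qed
  have ex: "salem_number salem_root \<and> is_minimal_polynomial P salem_root"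
    using salem_number_salem_root is_minimal_polynomial_P[OF poly_int_P_salem_root] by blast
  have "(8 / 5)\<^sup>2 < (5 :: real)" by (simp add: power2_eq_square)
  then have golden: "13 / 10 < (1 + sqrt 5) / 2" using real_less_rsqrt by fastforce
  have large: "\<exists>t>B. t > 0 \<and> (\<forall>n. even \<lfloor>t * salem_root ^ n\<rfloor>)" for B
  proof -
    obtain T M where T: "T > 0" "\<And>n. n \<ge> M \<Longrightarrow> even \<lfloor>T * salem_root ^ n\<rfloor>"
      using ex_even_floors unfolding eventually_sequentially by blast
    obtain K where "B / T < salem_root ^ K" using real_arch_pow[OF salem_root_gt_1] by blast
    also have "\<dots> \<le> salem_root ^ (M + K)"
      using salem_root_gt_1 by (intro power_increasing) auto
    finally have "B < T * salem_root ^ (M + K)" using T(1) by (simp add: field_simps)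
    moreover have "T * salem_root ^ (M + K) > 0" using T(1) salem_root_gt_1 by simp
    moreover have "even \<lfloor>T * salem_root ^ (M + K) * salem_root ^ n\<rfloor>" for n
      using T(2)[of "M + K + n"] by (simp add: power_add mult.assoc)
    ultimately show ?thesis by blast
  qed
  show ?thesis
  proof (rule conjI)
    show "\<exists>!\<gamma>. salem_number \<gamma> \<and> is_minimal_polynomial P \<gamma>"
      using unique ex by blast
    have "\<not> complete_sequence (\<lambda>n. \<lfloor>t * salem_root ^ n\<rfloor>)"
      if "t > 0 \<and> (\<forall>n. even \<lfloor>t * salem_root ^ n\<rfloor>)" for t
      using that by (intro not_complete_if_even) blast
    then show "\<forall>\<gamma>. salem_number \<gamma> \<and> is_minimal_polynomial P \<gamma> \<longrightarrow>
       6 / 5 < \<gamma> \<and> \<gamma> < 13 / 10 \<and> 13 / 10 < (1 + sqrt 5) / 2 \<and>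
       (\<forall>B. \<exists>t>B. t > 0 \<and> (\<forall>n. even \<lfloor>t * \<gamma> ^ n\<rfloor>)) \<and>
       (\<forall>t. t > 0 \<and> (\<forall>n. even \<lfloor>t * \<gamma> ^ n\<rfloor>) \<longrightarrow>
          \<not> complete_sequence (\<lambda>n. \<lfloor>t * \<gamma> ^ n\<rfloor>))"
      using unique salem_root_bounds golden large by metis
  qed
qed

end
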